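(* Let $k\ge 1$, let $G=(V,E)$ be a graph and let $T$ be any $k$-Steiner root of $G$. Then for every clique-intersection $X$ of $G$: (1) $\mathrm{Real}(T\langle X\rangle)=X$ and $\mathrm{diam}(T\langle X\rangle)\le k$; (2) if $T'_X$ is a subtree of $T$ with $T'_X\supsetneq T\langle X\rangle$, then either $X=\mathrm{Real}(T'_X)$ or $\mathrm{diam}(T'_X)>\mathrm{diam}(T\langle X\rangle)$; (3) if $X'$ is a clique-intersection of $G$ with $\mathcal{C}(T\langle X\rangle)\subseteq\mathcal{C}(T\langle X'\rangle)$, then $X\cup X'$ is a clique of $G$.
   Context: A $k$-Steiner root of $G=(V,E)$ is a tree $T$ with $V\subseteq V(T)$ such that for distinct $u,v\in V$, $uv\in E$ iff $\mathrm{dist}_T(u,v)\le k$. Nodes of $T$ in $V$ are real, the others Steiner; for a subtree $T'$, $\mathrm{Real}(T')=V(T')\cap V$. For a nonempty node set $X\subseteq V(T)$, $T\langle X\rangle$ denotes the smallest subtree of $T$ containing $X$. A clique-intersection of $G$ is a nonempty set that is the intersection of a family of (one or more) maximal cliques of $G$. For a tree $T$, $\mathcal{C}(T)$ is its center, the set of nodes of minimum eccentricity in $T$. *)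

theory Defs
  imports "Graph_Theory.Graph_Theory"
begin

text \<open>
  Finite simple undirected graphs are the library's \<open>pair_graph\<close>s: finite, loop-free,
  symmetric digraphs without parallel arcs, an edge \<open>uv\<close> being the pair of arcs
  \<open>(u,v)\<close>, \<open>(v,u)\<close>.

  The library's \<open>tree\<close> cannot be used for them: its \<open>forest\<close> forbids directed cycles,
  and in a symmetric digraph every edge yields the directed cycle \<open>u,v,u\<close> of length 2.
  The cycles of the undirected graph are the directed cycles of length at least 3.
\<close>

definition is_tree :: "'a pair_pre_digraph \<Rightarrow> bool" where
  "is_tree T \<longleftrightarrow> pair_graph T \<and> Digraph_Component.connected (with_proj T) \<and>
     \<not> (\<exists>p. pre_digraph.cycle (with_proj T) p \<and> 3 \<le> length p)"

definition is_subtree :: "'a pair_pre_digraph \<Rightarrow> 'a pair_pre_digraph \<Rightarrow> bool" where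
  "is_subtree S T \<longleftrightarrow> is_tree S \<and> subgraph (with_proj S) (with_proj T)"

text \<open>
  The following notions are only meaningful for (finite) connected graphs and are
  only used for trees.
\<close>

definition gdist :: "'a pair_pre_digraph \<Rightarrow> 'a \<Rightarrow> 'a \<Rightarrow> nat" where
  "gdist T u v = (LEAST n. \<exists>p. pre_digraph.awalk (with_proj T) u p v \<and> length p = n)"

definition diam :: "'a pair_pre_digraph \<Rightarrow> nat" where
  "diam T = Max {gdist T u v | u v. u \<in> pverts T \<and> v \<in> pverts T}"

definition eccentricity :: "'a pair_pre_digraph \<Rightarrow> 'a \<Rightarrow> nat" where
  "eccentricity T v = Max (gdist T v ` pverts T)"

definition center :: "'a pair_pre_digraph \<Rightarrow> 'a set" where
  "center T = {v \<in> pverts T. \<forall>w \<in> pverts T. eccentricity T v \<le> eccentricity T w}"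

definition is_smallest_subtree ::
    "'a pair_pre_digraph \<Rightarrow> 'a set \<Rightarrow> 'a pair_pre_digraph \<Rightarrow> bool" where
  "is_smallest_subtree T X S \<longleftrightarrow> is_subtree S T \<and> X \<subseteq> pverts S \<and>
     (\<forall>S'. is_subtree S' T \<and> X \<subseteq> pverts S' \<longrightarrow> subgraph (with_proj S) (with_proj S'))"

definition spanned_subtree :: "'a pair_pre_digraph \<Rightarrow> 'a set \<Rightarrow> 'a pair_pre_digraph" where
  "spanned_subtree T X = (THE S. is_smallest_subtree T X S)"

definition steiner_root :: "nat \<Rightarrow> 'a pair_pre_digraph \<Rightarrow> 'a pair_pre_digraph \<Rightarrow> bool" where
  "steiner_root k G T \<longleftrightarrow> is_tree T \<and> pverts G \<subseteq> pverts T \<and>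
     (\<forall>u \<in> pverts G. \<forall>v \<in> pverts G. u \<noteq> v \<longrightarrow> ((u, v) \<in> parcs G \<longleftrightarrow> gdist T u v \<le> k))"

definition Real_nodes :: "'a pair_pre_digraph \<Rightarrow> 'a pair_pre_digraph \<Rightarrow> 'a set" where
  "Real_nodes G S = pverts S \<inter> pverts G"

definition is_clique :: "'a pair_pre_digraph \<Rightarrow> 'a set \<Rightarrow> bool" where
  "is_clique G K \<longleftrightarrow> K \<subseteq> pverts G \<and> (\<forall>u \<in> K. \<forall>v \<in> K. u \<noteq> v \<longrightarrow> (u, v) \<in> parcs G)"

definition is_maximal_clique :: "'a pair_pre_digraph \<Rightarrow> 'a set \<Rightarrow> bool" where
  "is_maximal_clique G K \<longleftrightarrow> is_clique G K \<and> (\<forall>K'. is_clique G K' \<and> K \<subseteq> K' \<longrightarrow> K' = K)"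

definition clique_intersection :: "'a pair_pre_digraph \<Rightarrow> 'a set \<Rightarrow> bool" where
  "clique_intersection G X \<longleftrightarrow>
     X \<noteq> {} \<and> (\<exists>F. F \<noteq> {} \<and> (\<forall>K \<in> F. is_maximal_clique G K) \<and> X = \<Inter>F)"

end

theory Submission
  imports Defs
begin

text \<open>
  Everything follows from the four-point inequality
  \<open>d(a,b) + d(c,e) \<le> max (d(a,c) + d(b,e)) (d(a,e) + d(b,c))\<close> for tree distances.
  Let \<open>d(x,y)\<close> with \<open>x, y \<in> X\<close> realise the diameter of the spanned subtree. If \<open>v\<close> is a real
  node in a subtree of the same diameter containing \<open>X\<close>, or lies on a path between nodes of \<open>X\<close>,
  then every \<open>w\<close> within distance \<open>k\<close> of all of \<open>X\<close> is within distance \<open>k\<close> of \<open>v\<close>. Hence \<open>v\<close>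
  extends every maximal clique containing \<open>X\<close>, that is, \<open>v \<in> X\<close>.
  For the centers, the same inequality bounds the eccentricity of a center by half the
  diameter, rounded up, and two such bounds add up to at most \<open>k\<close>, except when both diameters
  equal \<open>k\<close> and \<open>k\<close> is odd.
\<close>

section \<open>Trees and uniqueness of paths\<close>

locale undirected_tree = pair_graph +
  assumes tree_connected: "Digraph_Component.connected (with_proj G)"
    and tree_acyclic: "cycle p \<Longrightarrow> length p < 3"

lemma is_tree_iff: "is_tree T \<longleftrightarrow> undirected_tree T"
  by (auto simp: is_tree_def undirected_tree_def undirected_tree_axioms_def not_le)

context undirected_tree
begin

lemma apath_of_arc:
  assumes "(u, v) \<in> parcs G"
  shows "apath u [(u, v)] v"
  using assms no_loops' wellformed' by (auto simp: apath_simps)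

lemma awalk_to_apath_verts_subset:
  assumes "awalk u p v"
  shows "set (pawalk_verts u (awalk_to_apath p)) \<subseteq> set (pawalk_verts u p)"
  using set_awalk_verts[OF assms] awalk_to_apath_subset[OF assms]
    set_awalk_verts[OF awalkI_apath[OF apath_awalk_to_apath[OF assms]]]
  by auto

text \<open>Appending the arc \<open>(v, u)\<close> closes the path into a directed cycle. By
  \<open>tree_acyclic\<close> it has length below 3, so \<open>p\<close> consists of one
  arc.\<close>

lemma apath_adjacent_unique:
  assumes uv: "(v, u) \<in> parcs G" and p: "apath u p v"
  shows "p = [(u, v)]"
proof -
  have ne: "u \<noteq> v" using uv no_loops' by auto
  have w: "awalk u p v" using p by (simp add: apath_def)
  have w': "awalk u (p @ [(v, u)]) u"
    using w arc_implies_awalk[OF uv] by (auto intro: awalk_appendI)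
  have last: "last (pawalk_verts u p) = v" using w by auto
  obtain e q where eq: "p = e # q" using w ne by (cases p) (auto simp: awalk_Nil_iff)
  have "pawalk_verts u (p @ [(v, u)]) = pawalk_verts u p @ [u]"
    using awalk_verts_append[OF w'] last by simp
  moreover have "distinct (tl (pawalk_verts u p) @ [u])"
    using p eq by (auto simp: apath_def awalk_Cons_iff)
  ultimately have "cycle (p @ [(v, u)])"
    unfolding cycle_def using w' by (intro exI[of _ u]) (simp add: eq)
  then have "length (p @ [(v, u)]) < 3" by (rule tree_acyclic)
  then have "q = []" using eq by simp
  then show ?thesis using w eq by (cases e) (auto simp: awalk_simps)
qed

text \<open>If two paths to \<open>v\<close> leave \<open>u\<close> along different arcs \<open>uw\<close> and \<open>uw'\<close>, then the detour
  from \<open>w\<close> to \<open>w'\<close> through \<open>v\<close> avoids \<open>u\<close>, so adding the arc \<open>w'u\<close> to it gives a path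
  from \<open>w\<close> to its neighbour \<open>u\<close> that is not the arc \<open>wu\<close>.\<close>

lemma apath_unique:
  assumes "apath u p v" "apath u q v"
  shows "p = q"
  using assms
proof (induction p arbitrary: u q)
  case Nil
  then show ?case using apath_nonempty_ends by (auto simp: apath_Nil_iff)
next
  case (Cons e p')
  obtain f q' where q: "q = f # q'"
    using Cons.prems apath_nonempty_ends by (cases q) (auto simp: apath_Nil_iff)
  define w w' where "w = snd e" and "w' = snd f"
  have e: "e = (u, w)" "(u, w) \<in> parcs G" and f: "f = (u, w')" "(u, w') \<in> parcs G"
    and p': "apath w p' v" and u1: "u \<notin> set (pawalk_verts w p')"
    and q': "apath w' q' v" and u2: "u \<notin> set (pawalk_verts w' q')"
    using Cons.prems by (auto simp: q apath_Cons_iff w_def w'_def prod_eq_iff) (metis prod.collapse)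
  have aw: "awalk w p' v" "awalk v (rev_path q') w'"
    using p' q' by (auto simp: apath_def)
  then have walk: "awalk w (p' @ rev_path q') w'" by (rule awalk_appendI)
  define r where "r = awalk_to_apath (p' @ rev_path q')"
  have r: "apath w r w'" unfolding r_def by (rule apath_awalk_to_apath[OF walk])
  have "set (pawalk_verts w r) \<subseteq> set (pawalk_verts w p') \<union> set (pawalk_verts v (rev_path q'))"
    using awalk_to_apath_verts_subset[OF walk] set_awalk_verts_append[OF aw] by (simp add: r_def)
  moreover have "set (pawalk_verts v (rev_path q')) = set (pawalk_verts w' q')"
    using awalk_verts_rev_path[of w' q' v] q' by (simp add: apath_def)
  ultimately have u3: "u \<notin> set (pawalk_verts w r)" using u1 u2 by blast
  have "awlast w r = w'" using r by (auto simp: apath_def)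
  then have "apath w (r @ [(w', u)]) u"
    using r u3 apath_of_arc[OF arcs_symmetric[OF f(2)]] by (simp add: apath_append_iff)
  from apath_adjacent_unique[OF e(2) this] have "w = w'" by simp
  then show ?case using Cons.IH[OF p'] q' by (simp add: q e(1) f(1))
qed

lemma ex_apath:
  assumes "u \<in> pverts G" "v \<in> pverts G"
  obtains p where "apath u p v"
proof -
  have "u \<rightarrow>\<^sup>*\<^bsub>mk_symmetric G\<^esub> v"
    using tree_connected assms by (auto simp: Digraph_Component.connected_def strongly_connected_def)
  then have "u \<rightarrow>\<^sup>*\<^bsub>with_proj G\<^esub> v" using reachable_mk_symmetric_eq[OF sym_arcs] by simp
  then show ?thesis using that reachable_apath by blast
qed

lemma pverts_nonempty: "pverts G \<noteq> {}"
  using tree_connected by (auto simp: Digraph_Component.connected_def strongly_connected_def)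

section \<open>Distances in a tree\<close>

text \<open>By uniqueness \<open>p\<close> is the path extracted from \<open>q\<close>, so its
  pairwise distinct nodes all occur on \<open>q\<close>; counting nodes compares the
  lengths.\<close>

lemma apath_length_le_awalk:
  assumes p: "apath u p v" and q: "awalk u q v"
  shows "length p \<le> length q"
proof -
  have "p = awalk_to_apath q"
    using apath_unique[OF p apath_awalk_to_apath[OF q]] .
  then have sub: "set (pawalk_verts u p) \<subseteq> set (pawalk_verts u q)"
    using awalk_to_apath_verts_subset[OF q] by simp
  have "Suc (length p) = card (set (pawalk_verts u p))"
    using p length_awalk_verts[of u p] by (simp add: apath_def distinct_card)
  also have "\<dots> \<le> card (set (pawalk_verts u q))" using sub by (simp add: card_mono)
  also have "\<dots> \<le> Suc (length q)"
    using card_length[of "pawalk_verts u q"] length_awalk_verts[of u q] by simp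
  finally show ?thesis by simp
qed

lemma gdist_apath:
  assumes "apath u p v"
  shows "gdist G u v = length p"
  unfolding gdist_def
  using assms apath_length_le_awalk[OF assms]
  by (intro Least_equality) (auto simp: apath_def)

lemma gdist_le_awalk:
  assumes "awalk u p v"
  shows "gdist G u v \<le> length p"
  unfolding gdist_def using assms by (intro Least_le) auto

lemma gdist_self [simp]: "u \<in> pverts G \<Longrightarrow> gdist G u u = 0"
  using gdist_apath[of u "[]" u] by (simp add: apath_Nil_iff)

lemma length_rev_path: "length (rev_path p) = length p"
  by (induction p) auto

lemma gdist_commute:
  assumes "u \<in> pverts G" "v \<in> pverts G"
  shows "gdist G u v = gdist G v u"
proof -
  obtain p where "apath u p v" using ex_apath assms .
  then show ?thesis
    using gdist_apath[of u p v] gdist_apath[of v "rev_path p" u] by (simp add: length_rev_path)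
qed

lemma gdist_triangle:
  assumes "u \<in> pverts G" "v \<in> pverts G" "w \<in> pverts G"
  shows "gdist G u w \<le> gdist G u v + gdist G v w"
proof -
  obtain p where p: "apath u p v" using ex_apath assms by metis
  obtain q where q: "apath v q w" using ex_apath assms by metis
  have "awalk u (p @ q) w" using p q by (intro awalk_appendI) (auto simp: apath_def)
  from gdist_le_awalk[OF this] show ?thesis by (simp add: gdist_apath[OF p] gdist_apath[OF q])
qed

lemma gdist_eq_0_iff:
  assumes "u \<in> pverts G" "v \<in> pverts G"
  shows "gdist G u v = 0 \<longleftrightarrow> u = v"
proof -
  obtain p where "apath u p v" using ex_apath assms .
  then show ?thesis using gdist_apath[of u p v] assms(1) by (auto simp: apath_Nil_iff)
qed

lemma gdist_arc: "(u, v) \<in> parcs G \<Longrightarrow> gdist G u v = 1"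
  using gdist_apath[OF apath_of_arc] by simp

lemma arc_if_gdist_1:
  assumes "u \<in> pverts G" "v \<in> pverts G" "gdist G u v = 1"
  shows "(u, v) \<in> parcs G"
proof -
  obtain p where p: "apath u p v" using ex_apath assms by metis
  then obtain e where "p = [e]" using gdist_apath[OF p] assms(3)
    by (metis One_nat_def length_0_conv length_Suc_conv)
  then show ?thesis using p by (cases e) (auto simp: apath_simps)
qed

lemma apath_split:
  assumes p: "apath u p v" and w: "w \<in> set (pawalk_verts u p)"
  obtains q r where "p = q @ r" "apath u q w" "apath w r v"
proof -
  obtain q r where qr: "p = q @ r" "awalk u q w" "awalk w r v"
    using awalk_decomp[of u p v w] p w by (auto simp: apath_def)
  moreover have "last (pawalk_verts u q) = w" using qr(2) by auto
  ultimately show ?thesis using that p by (auto simp: apath_append_iff)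
qed

lemma gdist_on_apath:
  assumes p: "apath u p v" and w: "w \<in> set (pawalk_verts u p)"
  shows "gdist G u w + gdist G w v = gdist G u v"
  using apath_split[OF assms] gdist_apath p by (metis length_append)

lemma apath_verts_in: "apath u p v \<Longrightarrow> w \<in> set (pawalk_verts u p) \<Longrightarrow> w \<in> pverts G"
  by (auto simp: apath_def)

lemma ex_at_gdist:
  assumes "u \<in> pverts G" "v \<in> pverts G" and i: "i \<le> gdist G u v"
  obtains m where "m \<in> pverts G" "gdist G u m = i" "gdist G m v = gdist G u v - i"
proof -
  obtain p where p: "apath u p v" using ex_apath assms by metis
  define m where "m = last (pawalk_verts u (take i p))"
  have "apath u (take i p @ drop i p) v" using p by simp
  then have "apath u (take i p) m" "apath m (drop i p) v"
    by (simp_all only: apath_append_iff m_def)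
  then show ?thesis using that[of m] gdist_apath i p by (auto simp: apath_def gdist_apath)
qed

section \<open>Bipartiteness and the four-point inequality\<close>

text \<open>Trees are bipartite: the path from \<open>x\<close> to \<open>a\<close> either already
  passes through \<open>b\<close> or extends to \<open>b\<close> by the arc.\<close>

lemma gdist_arc_cases:
  assumes x: "x \<in> pverts G" and arc: "(a, b) \<in> parcs G"
  shows "gdist G x b = gdist G x a + 1 \<or> gdist G x a = gdist G x b + 1"
proof -
  have ab: "a \<in> pverts G" "b \<in> pverts G" using arc wellformed' by auto
  obtain p where p: "apath x p a" using ex_apath x ab by metis
  show ?thesis
  proof (cases "b \<in> set (pawalk_verts x p)")
    case True
    from gdist_on_apath[OF p this] show ?thesis
      using gdist_arc[OF arcs_symmetric[OF arc]] by simp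
  next
    case False
    have "last (pawalk_verts x p) = a" using p by (auto simp: apath_def)
    then have "apath x (p @ [(a, b)]) b"
      using p False apath_of_arc[OF arc] by (simp add: apath_append_iff)
    from gdist_apath[OF this] show ?thesis using gdist_apath[OF p] by simp
  qed
qed

text \<open>The arc separates \<open>c\<close> from \<open>b\<close>: the path from \<open>c\<close>
  to \<open>a\<close>, the arc, and the path from \<open>a'\<close> to \<open>b\<close> join into a
  single path.\<close>

lemma gdist_across_arc:
  assumes arc: "(a, a') \<in> parcs G" and "c \<in> pverts G" "b \<in> pverts G"
    and c: "gdist G c a' = gdist G c a + 1" and b: "gdist G a b = gdist G a' b + 1"
  shows "gdist G c b = gdist G c a + gdist G a b"
proof -
  have aa: "a \<in> pverts G" "a' \<in> pverts G" using arc wellformed' by auto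
  obtain p where p: "apath c p a" using ex_apath assms aa by metis
  obtain q where q: "apath a' q b" using ex_apath assms aa by metis
  have disj: "set (pawalk_verts c p) \<inter> set (pawalk_verts a' q) = {}"
  proof (rule ccontr)
    assume "set (pawalk_verts c p) \<inter> set (pawalk_verts a' q) \<noteq> {}"
    then obtain u where u: "u \<in> set (pawalk_verts c p)" "u \<in> set (pawalk_verts a' q)" by blast
    have uG: "u \<in> pverts G" using apath_verts_in[OF p u(1)] .
    \<comment> \<open>A common node \<open>u\<close> would be strictly closer to \<open>a\<close>
      than to \<open>a'\<close> (as seen from \<open>c\<close>) and strictly closer to
      \<open>a'\<close> than to \<open>a\<close> (as seen from \<open>b\<close>).\<close>
    show False
      using gdist_on_apath[OF p u(1)] gdist_on_apath[OF q u(2)] c b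
        gdist_triangle[of c u a'] gdist_triangle[of a u b] gdist_commute[of u a]
        gdist_commute[of u a'] uG aa assms(2,3)
      by simp
  qed
  have lp: "last (pawalk_verts c p) = a" using p by (auto simp: apath_def)
  have "apath a ((a, a') # q) b"
    using q arc disj p lp last_in_set[of "pawalk_verts c p"] awalk_verts_non_Nil[of c p]
    by (auto simp: apath_Cons_iff)
  then have "apath c (p @ (a, a') # q) b"
    using p lp disj by (simp add: apath_append_iff)
  from gdist_apath[OF this] show ?thesis
    using gdist_apath[OF p] gdist_apath[OF q] b by simp
qed

text \<open>Induction along the path from \<open>a\<close> to \<open>b\<close>: a step that does not bring \<open>a\<close>
  closer to both \<open>c\<close> and \<open>e\<close> crosses an edge separating, say, \<open>c\<close> from \<open>b\<close>, and then
  the triangle inequality suffices.\<close>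

lemma four_point:
  assumes "a \<in> pverts G" "b \<in> pverts G" "c \<in> pverts G" "e \<in> pverts G"
  shows "gdist G a b + gdist G c e \<le>
    max (gdist G a c + gdist G b e) (gdist G a e + gdist G b c)"
  using assms
proof (induction "gdist G a b" arbitrary: a)
  case 0
  then have "a = b" using gdist_eq_0_iff by metis
  then show ?case
    using 0 gdist_triangle[of c a e] gdist_commute[of c a] by (simp add: max_def)
next
  case (Suc n)
  obtain a' where a': "a' \<in> pverts G" "gdist G a a' = 1" "gdist G a' b = gdist G a b - 1"
    using ex_at_gdist[of a b 1] Suc by auto
  have arc: "(a, a') \<in> parcs G" using arc_if_gdist_1 a' Suc by auto
  have ab: "gdist G a b = gdist G a' b + 1" using a' Suc.hyps by simp
  have IH: "gdist G a' b + gdist G c e \<le>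
    max (gdist G a' c + gdist G b e) (gdist G a' e + gdist G b c)"
    using Suc.hyps(1)[of a'] Suc.hyps(2) Suc.prems a' by simp
  have comm: "gdist G c a = gdist G a c" "gdist G c a' = gdist G a' c"
     "gdist G e a = gdist G a e" "gdist G e a' = gdist G a' e" 
     "gdist G c b = gdist G b c" "gdist G e b = gdist G b e" "gdist G c e = gdist G e c"
    using gdist_commute Suc.prems a' by auto
  consider "gdist G c a' = gdist G c a + 1" | "gdist G e a' = gdist G e a + 1"
    | "gdist G c a = gdist G c a' + 1" "gdist G e a = gdist G e a' + 1"
    using gdist_arc_cases[OF _ arc] Suc.prems by metis
  then show ?case
  proof cases
    case 1
    from gdist_across_arc[OF arc _ _ this ab] show ?thesis
      using gdist_triangle[of c a e] Suc.prems comm by simp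
  next
    case 2
    from gdist_across_arc[OF arc _ _ this ab] show ?thesis
      using gdist_triangle[of e a c] Suc.prems comm by simp
  next
    case 3
    then show ?thesis using IH ab comm by (simp add: max_def split: if_splits)
  qed
qed

section \<open>Diameter, eccentricity and center\<close>

lemma finite_gdists: "finite {gdist G u v | u v. u \<in> pverts G \<and> v \<in> pverts G}"
  using pair_finite_verts by (intro finite_image_set2) auto

lemma gdist_le_diam:
  assumes "u \<in> pverts G" "v \<in> pverts G"
  shows "gdist G u v \<le> diam G"
  unfolding diam_def using assms finite_gdists by (intro Max_ge) auto

lemma ex_gdist_eq_diam:
  obtains u v where "u \<in> pverts G" "v \<in> pverts G" "gdist G u v = diam G"
proof -
  have "diam G \<in> {gdist G u v | u v. u \<in> pverts G \<and> v \<in> pverts G}"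
    unfolding diam_def using finite_gdists pverts_nonempty by (intro Max_in) auto
  then show ?thesis using that by auto
qed

lemma eccentricity_le_iff:
  "eccentricity G v \<le> n \<longleftrightarrow> (\<forall>w \<in> pverts G. gdist G v w \<le> n)"
  unfolding eccentricity_def using pair_finite_verts pverts_nonempty by (simp add: Max_le_iff)

lemma gdist_le_eccentricity: "w \<in> pverts G \<Longrightarrow> gdist G v w \<le> eccentricity G v"
  using eccentricity_le_iff by blast

lemma diam_le_twice_eccentricity:
  assumes "v \<in> pverts G"
  shows "diam G \<le> 2 * eccentricity G v"
proof -
  obtain x y where xy: "x \<in> pverts G" "y \<in> pverts G" "gdist G x y = diam G"
    using ex_gdist_eq_diam .
  show ?thesis
    using gdist_triangle[of x v y] gdist_commute[of x v] gdist_le_eccentricity[of x v]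
      gdist_le_eccentricity[of y v] xy assms by simp
qed

text \<open>In the four-point inequality for \<open>w, m, x, y\<close>, the distances from
  \<open>w\<close> to \<open>x\<close> and \<open>y\<close> are at most \<open>d(x,y)\<close>, which
  cancels.\<close>

lemma eccentricity_on_diametral_path:
  assumes "x \<in> pverts G" "y \<in> pverts G" "gdist G x y = diam G" "m \<in> pverts G"
    and "gdist G x m + gdist G m y = diam G"
  shows "eccentricity G m \<le> max (gdist G x m) (gdist G m y)"
  unfolding eccentricity_le_iff
proof
  fix w assume w: "w \<in> pverts G"
  show "gdist G m w \<le> max (gdist G x m) (gdist G m y)"
    using four_point[OF w assms(4,1,2)] gdist_le_diam[OF w assms(1)] gdist_le_diam[OF w assms(2)]
      gdist_commute[OF w assms(4)] gdist_commute[OF assms(4,1)] assms(3)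
    by linarith
qed

text \<open>No eccentricity is below half the diameter, so a node that attains this bound, rounded
  up, is minimal.\<close>

lemma centerI:
  assumes "c \<in> pverts G" "2 * eccentricity G c \<le> diam G + 1"
  shows "c \<in> center G"
proof -
  have "eccentricity G c \<le> eccentricity G w" if "w \<in> pverts G" for w
    using diam_le_twice_eccentricity[OF that] assms(2) by linarith
  then show ?thesis using assms(1) by (simp add: center_def)
qed

text \<open>A center is no more eccentric than the middle node \<open>m\<close> of a diametral
  path.\<close>

lemma eccentricity_center:
  assumes "c \<in> center G"
  shows "2 * eccentricity G c \<le> diam G + 1"
proof -
  obtain x y where xy: "x \<in> pverts G" "y \<in> pverts G" "gdist G x y = diam G"
    using ex_gdist_eq_diam .
  obtain m where m: "m \<in> pverts G" "gdist G x m = diam G div 2"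
      "gdist G m y = diam G - diam G div 2"
    using ex_at_gdist[of x y "diam G div 2"] xy by auto
  have "eccentricity G m \<le> diam G - diam G div 2"
    using eccentricity_on_diametral_path[OF xy m(1)] m by simp
  moreover have "eccentricity G c \<le> eccentricity G m"
    using assms m(1) by (simp add: center_def)
  ultimately show ?thesis by linarith
qed

lemma center_nonempty: "center G \<noteq> {}"
proof -
  obtain c where "is_arg_min (eccentricity G) (\<lambda>v. v \<in> pverts G) c"
    using ex_is_arg_min_if_finite[OF pair_finite_verts pverts_nonempty] by blast
  then show ?thesis by (auto simp: center_def is_arg_min_linorder)
qed

text \<open>A diametral path of odd length has two adjacent middle nodes, both of eccentricity at
  most \<open>h + 1\<close>.\<close>

lemma center_arc_if_odd_diam:
  assumes "odd (diam G)"
  obtains a b where "a \<in> center G" "b \<in> center G" "(a, b) \<in> parcs G"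
proof -
  obtain h where h: "diam G = 2 * h + 1" using assms oddE by blast
  obtain x y where xy: "x \<in> pverts G" "y \<in> pverts G" "gdist G x y = diam G"
    using ex_gdist_eq_diam .
  obtain a where a: "a \<in> pverts G" "gdist G x a = h" "gdist G a y = h + 1"
    using ex_at_gdist[of x y h] xy h by auto
  obtain b where b: "b \<in> pverts G" "gdist G a b = 1" "gdist G b y = h"
    using ex_at_gdist[of a y 1] xy a by auto
  \<comment> \<open>The detour through \<open>a\<close> gives the upper bound; the lower bound holds
    because \<open>x\<close> and \<open>y\<close> are \<open>2 * h + 1\<close> apart and
    \<open>b\<close> is only \<open>h\<close> from \<open>y\<close>.\<close>
  have xb: "gdist G x b = h + 1"
    using gdist_triangle[of x a b] gdist_triangle[of x b y] xy a b h by simp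
  have "a \<in> center G"
    using eccentricity_on_diametral_path[OF xy a(1)] a h by (intro centerI) auto
  moreover have "b \<in> center G"
    using eccentricity_on_diametral_path[OF xy b(1)] b xb h by (intro centerI) auto
  ultimately show ?thesis using that arc_if_gdist_1 a b by blast
qed

section \<open>The spanned subtree as a union of paths\<close>

text \<open>For nonempty \<open>X\<close> inside the tree this is the node set of the smallest
  subtree containing \<open>X\<close>, in a form that exposes the paths needed for distance
  estimates.\<close>

definition path_hull :: "'a set \<Rightarrow> 'a set" where
  "path_hull X = {v. \<exists>x \<in> X. \<exists>y \<in> X. \<exists>p. apath x p y \<and> v \<in> set (pawalk_verts x p)}"

definition path_hull_graph :: "'a set \<Rightarrow> 'a pair_pre_digraph" where
  "path_hull_graph X =
    \<lparr>pverts = path_hull X, parcs = parcs G \<inter> path_hull X \<times> path_hull X\<rparr>"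

lemma path_hull_subset: "path_hull X \<subseteq> pverts G"
  by (auto simp: path_hull_def dest: apath_verts_in)

lemma subset_path_hull: "X \<subseteq> pverts G \<Longrightarrow> X \<subseteq> path_hull X"
  unfolding path_hull_def using apath_Nil_iff by fastforce

text \<open>The distance from any node \<open>w\<close> to the hull is maximised on \<open>X\<close>
  itself: apply the four-point inequality to \<open>w\<close>, \<open>v\<close> and the ends of a
  path through \<open>v\<close>.\<close>

lemma gdist_path_hull_le:
  assumes v: "v \<in> path_hull X" and w: "w \<in> pverts G" and X: "X \<subseteq> pverts G"
  obtains x where "x \<in> X" "gdist G w v \<le> gdist G w x"
proof -
  obtain x y p where xy: "x \<in> X" "y \<in> X" and p: "apath x p y" "v \<in> set (pawalk_verts x p)"
    using v by (auto simp: path_hull_def)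
  have G: "x \<in> pverts G" "y \<in> pverts G" "v \<in> pverts G" using xy X apath_verts_in[OF p] by auto
  have "gdist G w v \<le> gdist G w x \<or> gdist G w v \<le> gdist G w y"
    using four_point[OF w G(3,1,2)] gdist_on_apath[OF p] gdist_commute[OF G(3,1)]
    by linarith
  then show ?thesis using that xy by blast
qed

lemma subgraph_path_hull_graph: "subgraph (path_hull_graph X) G"
  using path_hull_subset
  by (auto simp: subgraph_def path_hull_graph_def wf_digraph_wp_iff pair_wf_digraph_def
      intro: wellformed' pair_wf_digraph)

text \<open>Cycles of a subgraph are cycles of the tree, so acyclicity is inherited; symmetry,
  nonemptiness and reachability remain to be checked.\<close>

lemma subtreeI:
  assumes sub: "subgraph (with_proj S) (with_proj G)"
    and sym: "\<And>u v. (u, v) \<in> parcs S \<Longrightarrow> (v, u) \<in> parcs S"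
    and ne: "pverts S \<noteq> {}"
    and reach: "\<And>u v. u \<in> pverts S \<Longrightarrow> v \<in> pverts S \<Longrightarrow> u \<rightarrow>\<^sup>*\<^bsub>with_proj S\<^esub> v"
  shows "is_subtree S G"
proof -
  interpret D: digraph "with_proj S" using digraph_subgraph[OF sub] .
  have symS: "symmetric (with_proj S)" using sym by (auto simp: symmetric_def intro: symI)
  have "pair_graph S"
    using D.finite_verts D.finite_arcs D.wellformed D.no_loops symS
    by unfold_locales auto
  moreover have "Digraph_Component.connected (with_proj S)"
    using ne reach D.reachable_mk_symmetric_eq[OF symS]
    by (auto simp: Digraph_Component.connected_def strongly_connected_def)
  moreover have "length p < 3" if "pre_digraph.cycle (with_proj S) p" for p
    using subgraph_cycle[OF sub that] tree_acyclic by blast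
  ultimately show ?thesis using sub by (auto simp: is_subtree_def is_tree_def not_le)
qed

lemma is_subtree_path_hull_graph:
  assumes X: "X \<noteq> {}" "X \<subseteq> pverts G"
  shows "is_subtree (path_hull_graph X) G"
proof (rule subtreeI[OF subgraph_path_hull_graph])
  let ?H = "path_hull_graph X"
  interpret H: pair_wf_digraph ?H
    using subgraph_path_hull_graph[of X] by (simp add: subgraph_def wf_digraph_wp_iff)
  show sym: "(v, u) \<in> parcs ?H" if "(u, v) \<in> parcs ?H" for u v
    using that arcs_symmetric by (auto simp: path_hull_graph_def)
  interpret H: pair_sym_digraph ?H
    using sym by unfold_locales (auto simp: symmetric_def intro: symI)
  show "pverts ?H \<noteq> {}" using X subset_path_hull by (auto simp: path_hull_graph_def)
  have walk: "H.awalk x q v" if "apath x q v" "set (pawalk_verts x q) \<subseteq> path_hull X" for x q v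
    using that
  proof (induction q arbitrary: x)
    case Nil
    moreover have "pverts ?H = path_hull X" by (simp add: path_hull_graph_def)
    ultimately show ?case by (simp add: apath_Nil_iff H.awalk_Nil_iff)
  next
    case (Cons e q)
    then have "snd e \<in> path_hull X"
      using hd_in_awalk_verts(2)[of "snd e" q v] by (auto simp: apath_Cons_iff)
    then have "e \<in> parcs ?H"
      using Cons.prems by (auto simp: apath_Cons_iff path_hull_graph_def mem_Times_iff)
    then show ?case using Cons by (auto simp: apath_Cons_iff H.awalk_Cons_iff)
  qed
  have prefix: "\<exists>q. H.awalk x q v"
    if p: "apath x p y" "v \<in> set (pawalk_verts x p)" and xy: "x \<in> X" "y \<in> X" for x p y v
  proof -
    obtain q r where qr: "p = q @ r" "apath x q v" "apath v r y" using apath_split[OF p] .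
    have "awalk x q v" "awalk v r y" using qr by (auto simp: apath_def)
    from set_awalk_verts_append[OF this]
    have "set (pawalk_verts x q) \<subseteq> set (pawalk_verts x p)" using qr by simp
    also have "\<dots> \<subseteq> path_hull X" using p xy by (auto simp: path_hull_def)
    finally show ?thesis using walk[OF qr(2)] by blast
  qed
  obtain x0 where x0: "x0 \<in> X" using X by blast
  \<comment> \<open>Go from \<open>x0\<close> to the end \<open>x\<close> of a path through
    \<open>v\<close>, then along that path up to \<open>v\<close>. Both pieces run between nodes of
    \<open>X\<close>, hence inside the hull.\<close>
  have from_x0: "\<exists>q. H.awalk x0 q v" if v: "v \<in> path_hull X" for v
  proof -
    obtain x y p where p: "apath x p y" "v \<in> set (pawalk_verts x p)" "x \<in> X" "y \<in> X"
      using v by (auto simp: path_hull_def)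
    obtain p' where p': "apath x0 p' x" using ex_apath x0 p X by blast
    have "last (pawalk_verts x0 p') = x" using p' by (auto simp: apath_def)
    then have "x \<in> set (pawalk_verts x0 p')"
      using last_in_set[OF awalk_verts_non_Nil[of x0 p']] by simp
    then obtain q where "H.awalk x0 q x" using prefix[OF p' _ x0 p(3)] by blast
    moreover obtain r where "H.awalk x r v" using prefix[OF p] by blast
    ultimately show ?thesis using H.awalk_appendI by blast
  qed
  fix u v assume "u \<in> pverts ?H" "v \<in> pverts ?H"
  then have "u \<in> path_hull X" "v \<in> path_hull X" by (simp_all add: path_hull_graph_def)
  then obtain q r where "H.awalk x0 q u" "H.awalk x0 r v"
    using from_x0 by blast
  then have "H.awalk u (rev_path q @ r) v" by (intro H.awalk_appendI[of _ _ x0]) auto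
  then show "u \<rightarrow>\<^sup>*\<^bsub>with_proj ?H\<^esub> v" by (rule H.reachable_awalkI)
qed

end

section \<open>Subtrees inherit paths and distances\<close>

locale subtree = undirected_tree T + S: undirected_tree S for T S :: "'a pair_pre_digraph" +
  assumes sub: "subgraph (with_proj S) (with_proj T)"
begin

text \<open>The subtree has its own path from \<open>u\<close> to \<open>v\<close>; it is also a
  path of \<open>T\<close>, so uniqueness identifies the two.\<close>

lemma apath_subtree:
  assumes "u \<in> pverts S" "v \<in> pverts S" "apath u p v"
  shows "S.apath u p v"
proof -
  obtain q where q: "S.apath u q v" using S.ex_apath[OF assms(1,2)] .
  have "apath u q v" using subgraph_apath_imp_apath[OF q sub] .
  then show ?thesis using apath_unique[OF assms(3)] q by simp
qed

lemma gdist_subtree: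
  assumes "u \<in> pverts S" "v \<in> pverts S"
  shows "gdist S u v = gdist T u v"
proof -
  obtain q where q: "S.apath u q v" using S.ex_apath[OF assms(1,2)] .
  have "apath u q v" using subgraph_apath_imp_apath[OF q sub] .
  then show ?thesis using S.gdist_apath[OF q] gdist_apath by simp
qed

text \<open>Subtrees are induced subgraphs, since adjacency is distance 1 and distances
  agree.\<close>

lemma parcs_subtree:
  assumes "u \<in> pverts S" "v \<in> pverts S" "(u, v) \<in> parcs T"
  shows "(u, v) \<in> parcs S"
  using S.arc_if_gdist_1[OF assms(1,2)] gdist_subtree[OF assms(1,2)] gdist_arc[OF assms(3)] by simp

lemma subset_pverts: "pverts S \<subseteq> pverts T"
  using sub by (auto simp: subgraph_def)

lemma path_hull_subset_subtree:
  assumes "X \<subseteq> pverts S"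
  shows "path_hull X \<subseteq> pverts S"
proof
  fix v assume "v \<in> path_hull X"
  then obtain x y p where p: "x \<in> X" "y \<in> X" "apath x p y" "v \<in> set (pawalk_verts x p)"
    by (auto simp: path_hull_def)
  then have "S.apath x p y" using apath_subtree assms by blast
  then show "v \<in> pverts S" using S.apath_verts_in p(4) by simp
qed

lemma subgraph_path_hull_graph_subtree:
  assumes "X \<subseteq> pverts S"
  shows "subgraph (path_hull_graph X) S"
proof -
  have "parcs (path_hull_graph X) \<subseteq> parcs S"
    using path_hull_subset_subtree[OF assms] parcs_subtree
    by (fastforce simp: path_hull_graph_def)
  then show ?thesis
    using path_hull_subset_subtree[OF assms] subgraph_path_hull_graph[of X] sub
    by (auto simp: subgraph_def path_hull_graph_def)
qed

end

lemma subtree_if_is_subtree: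
  assumes "is_tree T" "is_subtree S T"
  shows "subtree T S"
  using assms by (auto simp: is_subtree_def is_tree_iff subtree_def subtree_axioms_def)

text \<open>Justifies the definite description: the path hull graph is a smallest subtree, and two
  smallest subtrees contain each other.\<close>

lemma spanned_subtree_eq:
  assumes T: "is_tree T" and X: "X \<noteq> {}" "X \<subseteq> pverts T"
  shows "spanned_subtree T X = undirected_tree.path_hull_graph T X"
proof -
  interpret undirected_tree T using T by (simp add: is_tree_iff)
  have "is_smallest_subtree T X (path_hull_graph X)"
    unfolding is_smallest_subtree_def
  proof (intro conjI allI impI)
    show "is_subtree (path_hull_graph X) T" using is_subtree_path_hull_graph[OF X] .
    show "X \<subseteq> pverts (path_hull_graph X)"
      using subset_path_hull[OF X(2)] by (simp add: path_hull_graph_def)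
    fix S assume "is_subtree S T \<and> X \<subseteq> pverts S"
    then show "subgraph (path_hull_graph X) S"
      using subtree.subgraph_path_hull_graph_subtree[OF subtree_if_is_subtree[OF T]] by simp
  qed
  moreover have "S = S'" if "is_smallest_subtree T X S" "is_smallest_subtree T X S'" for S S'
  proof -
    have "subgraph (with_proj S) (with_proj S')" "subgraph (with_proj S') (with_proj S)"
      using that by (simp_all add: is_smallest_subtree_def)
    then show ?thesis by (intro pair_pre_digraph.equality) (auto simp: subgraph_def)
  qed
  ultimately show ?thesis unfolding spanned_subtree_def by (intro the_equality) auto
qed


section \<open>Cliques as sets of diameter at most \<open>k\<close>\<close>

lemma gdist_le_if_is_clique:
  assumes "steiner_root k G T" "is_clique G K" "u \<in> K" "v \<in> K"
  shows "gdist T u v \<le> k"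
proof (cases "u = v")
  case True
  then show ?thesis
    using assms undirected_tree.gdist_self[of T u]
    by (auto simp: steiner_root_def is_clique_def is_tree_iff)
next
  case False
  then show ?thesis using assms unfolding steiner_root_def is_clique_def by blast
qed

lemma is_clique_if_gdist_le:
  assumes "steiner_root k G T" "K \<subseteq> pverts G"
    and "\<And>u v. u \<in> K \<Longrightarrow> v \<in> K \<Longrightarrow> gdist T u v \<le> k"
  shows "is_clique G K"
  using assms by (auto simp: steiner_root_def is_clique_def subset_iff)

lemma is_clique_clique_intersection:
  assumes "clique_intersection G X"
  shows "is_clique G X"
  using assms
  by (fastforce simp: clique_intersection_def is_maximal_clique_def is_clique_def)

text \<open>Each maximal clique \<open>K\<close> of the family contains \<open>X\<close>, so
  \<open>near\<close> applies to all its members. Then \<open>insert v K\<close> is a clique, and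
  maximality puts \<open>v\<close> into \<open>K\<close>.\<close>

lemma in_clique_intersectionI:
  assumes root: "steiner_root k G T" and X: "clique_intersection G X" and v: "v \<in> pverts G"
    and near: "\<And>w. w \<in> pverts G \<Longrightarrow> (\<And>x. x \<in> X \<Longrightarrow> gdist T w x \<le> k) \<Longrightarrow> gdist T w v \<le> k"
  shows "v \<in> X"
proof -
  interpret undirected_tree T using root by (simp add: steiner_root_def is_tree_iff)
  have VT: "pverts G \<subseteq> pverts T" using root by (simp add: steiner_root_def)
  obtain F where F: "\<forall>K \<in> F. is_maximal_clique G K" "X = \<Inter>F"
    using X by (auto simp: clique_intersection_def)
  have "v \<in> K" if K: "K \<in> F" for K
  proof -
    have cl: "is_clique G K" using F K by (simp add: is_maximal_clique_def)
    then have KG: "K \<subseteq> pverts G" by (simp add: is_clique_def)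
    have wv: "gdist T w v \<le> k" if "w \<in> K" for w
      using near[of w] gdist_le_if_is_clique[OF root cl that] F K KG that by blast
    moreover have "gdist T v w = gdist T w v" if "w \<in> K" for w
      using gdist_commute[of v w] VT KG v that by blast
    moreover have "gdist T v v \<le> k" using VT v by auto
    ultimately have "gdist T a b \<le> k" if "a \<in> insert v K" "b \<in> insert v K" for a b
      using gdist_le_if_is_clique[OF root cl] that by auto
    then have "is_clique G (insert v K)"
      using KG v by (intro is_clique_if_gdist_le[OF root]) auto
    then show ?thesis using F K by (auto simp: is_maximal_clique_def)
  qed
  then show ?thesis using F by blast
qed

section \<open>Real nodes and diameter of the spanned subtree\<close>

locale clique_intersection_root =
  fixes k :: nat and G T :: "'a pair_pre_digraph" and X :: "'a set"
  assumes root: "steiner_root k G T" and X: "clique_intersection G X"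
begin

abbreviation "H \<equiv> spanned_subtree T X"

lemma X_nonempty: "X \<noteq> {}" using X by (simp add: clique_intersection_def)

lemma X_subset: "X \<subseteq> pverts G" "X \<subseteq> pverts T"
  using is_clique_clique_intersection[OF X] root by (auto simp: is_clique_def steiner_root_def)

lemma tree_T: "is_tree T" using root by (simp add: steiner_root_def)

sublocale undirected_tree T using tree_T by (simp add: is_tree_iff)

lemma H_eq: "H = path_hull_graph X"
  using spanned_subtree_eq[OF tree_T X_nonempty X_subset(2)] .

lemma pverts_H: "pverts H = path_hull X"
  by (simp add: H_eq path_hull_graph_def)

lemma is_subtree_H: "is_subtree H T"
  using is_subtree_path_hull_graph[OF X_nonempty X_subset(2)] by (simp add: H_eq)

sublocale H: subtree T H using subtree_if_is_subtree[OF tree_T is_subtree_H] .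

lemma Real_nodes_H: "Real_nodes G H = X"
proof -
  have "v \<in> X" if v: "v \<in> path_hull X" "v \<in> pverts G" for v
  proof (rule in_clique_intersectionI[OF root X v(2)])
    fix w assume w: "w \<in> pverts G" "\<And>x. x \<in> X \<Longrightarrow> gdist T w x \<le> k"
    then have "w \<in> pverts T" using root by (auto simp: steiner_root_def)
    then show "gdist T w v \<le> k"
      using gdist_path_hull_le[OF v(1) _ X_subset(2), of w] w(2) le_trans by metis
  qed
  then show ?thesis
    using subset_path_hull X_subset by (auto simp: Real_nodes_def pverts_H)
qed

text \<open>Starting from a diametral pair of \<open>H\<close>, replace one end and then the other
  by a node of \<open>X\<close> that is at least as far away.\<close>

lemma diam_attained_in_X:
  obtains x y where "x \<in> X" "y \<in> X" "gdist T x y = diam H"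
proof -
  obtain u v where uv: "u \<in> pverts H" "v \<in> pverts H" "gdist H u v = diam H"
    using H.S.ex_gdist_eq_diam .
  have T: "u \<in> pverts T" "v \<in> pverts T" using uv H.subset_pverts by auto
  have XH: "X \<subseteq> pverts H" using subset_path_hull[OF X_subset(2)] pverts_H by simp
  obtain x where x: "x \<in> X" "gdist T u v \<le> gdist T u x"
    using gdist_path_hull_le uv(2) T(1) X_subset(2) pverts_H by metis
  obtain y where y: "y \<in> X" "gdist T x u \<le> gdist T x y"
    using gdist_path_hull_le[of u X x] uv(1) x(1) X_subset(2) pverts_H by blast
  have "gdist T x y \<le> diam H"
    using H.S.gdist_le_diam[of x y] H.gdist_subtree[of x y] x y XH by auto
  moreover have "gdist T x u = gdist T u x" using gdist_commute T x X_subset(2) by blast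
  ultimately have "gdist T x y = diam H"
    using x y uv H.gdist_subtree[OF uv(1,2)] by simp
  then show ?thesis using that x y by blast
qed

lemma diam_H_le: "diam H \<le> k"
  using diam_attained_in_X gdist_le_if_is_clique[OF root is_clique_clique_intersection[OF X]]
  by metis

text \<open>This is the second clause with the diameter alternative excluded.\<close>

lemma Real_nodes_larger_subtree:
  assumes T': "is_subtree T' T" and HT': "subgraph H T'" and "diam T' \<le> diam H"
  shows "Real_nodes G T' = X"
proof -
  interpret T': subtree T T' using subtree_if_is_subtree[OF tree_T T'] .
  have XT': "X \<subseteq> pverts T'"
    using HT' subset_path_hull[OF X_subset(2)] pverts_H by (auto simp: subgraph_def)
  obtain x y where xy: "x \<in> X" "y \<in> X" "gdist T x y = diam H" using diam_attained_in_X .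
  have "v \<in> X" if v: "v \<in> pverts T'" "v \<in> pverts G" for v
  proof (rule in_clique_intersectionI[OF root X v(2)])
    fix w assume w: "w \<in> pverts G" "\<And>x. x \<in> X \<Longrightarrow> gdist T w x \<le> k"
    have in_T: "w \<in> pverts T" "v \<in> pverts T" "x \<in> pverts T" "y \<in> pverts T"
      using w v xy X_subset root by (auto simp: steiner_root_def)
    have "gdist T v x \<le> diam H" "gdist T v y \<le> diam H"
      using T'.S.gdist_le_diam[of v x] T'.S.gdist_le_diam[of v y] T'.gdist_subtree v xy XT'
        assms(3) by (auto simp: subset_iff intro: le_trans)
    \<comment> \<open>Both distances from \<open>v\<close> are at most \<open>d(x,y)\<close>, so
      \<open>d(x,y)\<close> cancels in the four-point inequality for
      \<open>w, v, x, y\<close>.\<close>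
    then show "gdist T w v \<le> k"
      using four_point[OF in_T] w(2)[OF xy(1)] w(2)[OF xy(2)] xy(3) by linarith
  qed
  then show ?thesis using XT' X_subset by (auto simp: Real_nodes_def)
qed

section \<open>Centers and unions of clique-intersections\<close>

lemma gdist_center_le:
  assumes "c \<in> center H" "x \<in> X"
  shows "2 * gdist T x c \<le> diam H + 1"
proof -
  have c: "c \<in> pverts H" using assms by (simp add: center_def)
  have x: "x \<in> pverts H" using assms subset_path_hull[OF X_subset(2)] pverts_H by auto
  have "gdist T x c = gdist H c x"
    using H.gdist_subtree[OF c x] gdist_commute[of x c] c x H.subset_pverts by auto
  then show ?thesis
    using H.S.eccentricity_center[OF assms(1)] H.S.gdist_le_eccentricity[OF x, of c] by linarith
qed

end

text \<open>If both diameters equal \<open>k = 2 h + 1\<close>, then a single common center only gives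
  the bound \<open>2 h + 2\<close>. The second center saves one: by bipartiteness, \<open>x\<close> is at
  distance at most \<open>h\<close> from one of the two.\<close>

lemma gdist_le_of_center_subset:
  assumes root: "steiner_root k G T"
    and X: "clique_intersection G X" "x \<in> X"
    and X': "clique_intersection G X'" "x' \<in> X'"
    and center: "center (spanned_subtree T X) \<subseteq> center (spanned_subtree T X')"
  shows "gdist T x x' \<le> k"
proof -
  interpret A: clique_intersection_root k G T X using root X by unfold_locales
  interpret B: clique_intersection_root k G T X' using root X' by unfold_locales
  have x: "x \<in> pverts T" and x': "x' \<in> pverts T" using A.X_subset B.X_subset X X' by auto
  have via: "gdist T x x' \<le> gdist T x c + gdist T x' c \<and> 2 * gdist T x c \<le> diam A.H + 1 \<and>
      2 * gdist T x' c \<le> diam B.H + 1"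
    if c: "c \<in> center A.H" for c
  proof -
    have "c \<in> pverts T" using c A.H.subset_pverts by (auto simp: center_def)
    then show ?thesis
      using A.gdist_triangle[OF x _ x'] A.gdist_commute[OF x', of c] c center
        A.gdist_center_le[OF c X(2)] B.gdist_center_le[OF _ X'(2), of c] by auto
  qed
  show ?thesis
  proof (cases "odd k \<and> diam A.H = k \<and> diam B.H = k")
    case True
    then obtain a b where ab: "a \<in> center A.H" "b \<in> center A.H" "(a, b) \<in> parcs A.H"
      using A.H.S.center_arc_if_odd_diam by metis
    have "(a, b) \<in> parcs T" using ab(3) A.H.sub by (auto simp: subgraph_def)
    from A.gdist_arc_cases[OF x this] show ?thesis
      \<comment> \<open>With \<open>k = 2 * h + 1\<close>, all distances from \<open>x\<close> and
        \<open>x'\<close> to \<open>a\<close> and \<open>b\<close> are at most \<open>h + 1\<close>.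
        Those from \<open>x\<close> differ by one, so one is at most \<open>h\<close>, and
        \<open>h + (h + 1) = k\<close>.\<close>
      using via[OF ab(1)] via[OF ab(2)] True by (elim disjE oddE conjE) linarith+
  next
    case False
    obtain c where c: "c \<in> center A.H" using A.H.S.center_nonempty by blast
    \<comment> \<open>Two halves rounded up can exceed \<open>k\<close> only if both diameters equal
      an odd \<open>k\<close>, so here any one common center suffices.\<close>
    have "p + q \<le> k"
      if "2 * p \<le> m + 1" "2 * q \<le> n + 1" "m \<le> k" "n \<le> k" "\<not> (odd k \<and> m = k \<and> n = k)"
      for p q m n :: nat
      using that by presburger
    from this[OF _ _ A.diam_H_le B.diam_H_le False] show ?thesis
      using via[OF c] le_trans by blast
  qed
qed

text \<open>Only pairs with one node in each set need the centers; the others lie in a common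
  clique.\<close>

lemma is_clique_Un_if_center_subset:
  assumes root: "steiner_root k G T"
    and X: "clique_intersection G X" and X': "clique_intersection G X'"
    and center: "center (spanned_subtree T X) \<subseteq> center (spanned_subtree T X')"
  shows "is_clique G (X \<union> X')"
proof (rule is_clique_if_gdist_le[OF root])
  interpret A: clique_intersection_root k G T X using root X by unfold_locales
  interpret B: clique_intersection_root k G T X' using root X' by unfold_locales
  show "X \<union> X' \<subseteq> pverts G" using A.X_subset B.X_subset by blast
  have cross: "gdist T x x' \<le> k" "gdist T x' x \<le> k" if "x \<in> X" "x' \<in> X'" for x x'
    using gdist_le_of_center_subset[OF root X that(1) X' that(2) center]
      A.gdist_commute[OF subsetD[OF A.X_subset(2) that(1)] subsetD[OF B.X_subset(2) that(2)]]
    by simp_all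
  fix u v assume "u \<in> X \<union> X'" "v \<in> X \<union> X'"
  then show "gdist T u v \<le> k"
    using cross gdist_le_if_is_clique[OF root is_clique_clique_intersection[OF X]]
      gdist_le_if_is_clique[OF root is_clique_clique_intersection[OF X']] by blast
qed

theorem theorem3p4:
  fixes k :: nat and G T :: "'a pair_pre_digraph" and X :: "'a set"
  assumes "k \<ge> 1"
    and "pair_graph G"
    and "steiner_root k G T"
    and "clique_intersection G X"
  shows "(Real_nodes G (spanned_subtree T X) = X \<and> diam (spanned_subtree T X) \<le> k) \<and>
    (\<forall>T'. is_subtree T' T \<and>
        subgraph (with_proj (spanned_subtree T X)) (with_proj T') \<and> T' \<noteq> spanned_subtree T X \<longrightarrow>
        X = Real_nodes G T' \<or> diam T' > diam (spanned_subtree T X)) \<and>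
    (\<forall>X'. clique_intersection G X' \<and>
        center (spanned_subtree T X) \<subseteq> center (spanned_subtree T X') \<longrightarrow>
        is_clique G (X \<union> X'))"
proof -
  have R: "clique_intersection_root k G T X"
    by (rule clique_intersection_root.intro[OF assms(3,4)])
  show ?thesis
  proof (intro conjI allI impI)
    show "Real_nodes G (spanned_subtree T X) = X" "diam (spanned_subtree T X) \<le> k"
      using clique_intersection_root.Real_nodes_H[OF R] clique_intersection_root.diam_H_le[OF R]
      by this
  next
    fix T' assume "is_subtree T' T \<and> subgraph (with_proj (spanned_subtree T X)) (with_proj T') \<and>
      T' \<noteq> spanned_subtree T X"
    then show "X = Real_nodes G T' \<or> diam T' > diam (spanned_subtree T X)"
      using clique_intersection_root.Real_nodes_larger_subtree[OF R, of T']
      by (metis not_le)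
  next
    fix X' assume "clique_intersection G X' \<and>
      center (spanned_subtree T X) \<subseteq> center (spanned_subtree T X')"
    then show "is_clique G (X \<union> X')"
      using is_clique_Un_if_center_subset[OF assms(3,4)] by simp
  qed
qed

end
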